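(* The incremental topological ordering method using compatible search with a soft threshold, as described in the context, is correct: every search terminates; upon addition of an arc $(v,w)$ a cycle is reported if and only if adding $(v,w)$ creates a cycle; and after each arc addition that does not create a cycle, the maintained vertex order is a topological order of the current graph.
   Context: Setting: a fixed finite vertex set $V$; initially no arcs; arcs are added one at a time (the process stops once a cycle is reported). A topological order is a total order $<$ of the vertices with $x<y$ for every arc $(x,y)$. The method maintains a total order $<$ of $V$ (initially arbitrary) and, for each vertex, its sets of outgoing and incoming arcs. To add an arc $(v,w)$: add it to the outgoing set of $v$ and incoming set of $w$. If $v<w$, stop. Otherwise perform the following compatible search. A vertex is forward if it is $w$ or was reached from $w$ by traversing arcs forward, backward if it is $v$ or was reached from $v$ by traversing arcs backward; all other vertices are unreached. Maintain a low hard threshold $l$, a high hard threshold $h$, a soft threshold $s$ (all vertices), sets $A,B$ of candidate forward vertices, sets $C,D$ of candidate backward vertices, and sets $X,Y$. Initialize $l=w$, $h=v$, $s$ to $v$, $w$, or any vertex between them, $A=\{w\}$, $C=\{v\}$, $B=D=X=Y=\emptyset$. Repeat an applicable one of the following cases until $A\cup B$ or $C\cup D$ is empty: Case 1f: $A=\emptyset$: move all of $B$ into $A$, set $l=s$, let $s$ be a vertex of $A$, and then set $s=\min\{s,h\}$. Case 1b: $C=\emptyset$: move all of $D$ into $C$, set $h=s$, let $s$ be a vertex of $C$, and then set $s=\max\{s,l\}$. Otherwise choose $u\in A$ and $z\in C$. Case 2f: $u\ge h$: delete $u$ from $A$. Case 2b: $z\le l$: delete $z$ from $C$. Case 3f: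 $\max\{z,s\}\le u<h$: move $u$ from $A$ to $B$. Case 3b: $l<z\le \min\{u,s\}$: move $z$ from $C$ to $D$. (In the remaining cases $l\le u<z\le h$.) Case 4f: all arcs out of $u$ have been traversed: move $u$ from $A$ to $X$. Case 4b: all arcs into $z$ have been traversed: move $z$ from $C$ to $Y$. Case 5: otherwise traverse an untraversed arc $(u,x)$ out of $u$ and an untraversed arc $(y,z)$ into $z$. If $x$ is backward or $y$ is forward, stop and report a cycle. If $x$ is unreached, make it forward and add it to $A$; if $y$ is unreached, make it backward and add it to $C$. If the search stops without reporting a cycle, set $s=h$ if $A\cup B$ is empty and $s=l$ otherwise; delete from $X$ all vertices $\ge s$ and from $Y$ all vertices $\le s$. Compute topological orders $O_X$, $O_Y$ of the subgraphs induced by $X$ and $Y$. If $s$ is not forward, delete the vertices of $X\cup Y$ from the order and reinsert them just after $s$ in order $O_Y$ followed by $O_X$; otherwise reinsert them just before $s$ in order $O_Y$ followed by $O_X$.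
   Formalization: Added arcs are assumed not to be loops (on a loop the search stops without reporting a cycle); Cases 2f/2b take precedence over 3f/3b (otherwise a search may run forever); in Case 5 the cycle test is made after both arcs are traversed, so x = y reports a cycle. *)

theory Defs
  imports Main
begin

text \<open>
  A total order on a finite vertex set is kept as the duplicate-free list of its vertices in
  increasing order, so that deleting and reinserting vertices are list operations.
\<close>

definition before :: "'a list \<Rightarrow> 'a rel" where
  "before L = {(L ! i, L ! j) | i j. i < j \<and> j < length L}"

definition lt :: "'a list \<Rightarrow> 'a \<Rightarrow> 'a \<Rightarrow> bool" where
  "lt L x y \<longleftrightarrow> (x, y) \<in> before L"

definition le :: "'a list \<Rightarrow> 'a \<Rightarrow> 'a \<Rightarrow> bool" where
  "le L x y \<longleftrightarrow> x = y \<or> lt L x y"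

definition min_in :: "'a list \<Rightarrow> 'a \<Rightarrow> 'a \<Rightarrow> 'a" where
  "min_in L x y = (if le L x y then x else y)"

definition max_in :: "'a list \<Rightarrow> 'a \<Rightarrow> 'a \<Rightarrow> 'a" where
  "max_in L x y = (if le L x y then y else x)"

definition topological_order :: "'a set \<Rightarrow> 'a rel \<Rightarrow> 'a rel \<Rightarrow> bool" where
  "topological_order V E r \<longleftrightarrow>
     r \<subseteq> V \<times> V \<and> strict_linear_order_on V r \<and> (\<forall>(x, y) \<in> E. (x, y) \<in> r)"

definition order_list :: "'a set \<Rightarrow> 'a list \<Rightarrow> bool" where
  "order_list V L \<longleftrightarrow> distinct L \<and> set L = V"

definition topological_list :: "'a set \<Rightarrow> 'a rel \<Rightarrow> 'a list \<Rightarrow> bool" where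
  "topological_list V E L \<longleftrightarrow> order_list V L \<and> topological_order V E (before L)"

definition out_arcs :: "'a rel \<Rightarrow> 'a \<Rightarrow> 'a rel" where
  "out_arcs E u = {(a, b) \<in> E. a = u}"

definition in_arcs :: "'a rel \<Rightarrow> 'a \<Rightarrow> 'a rel" where
  "in_arcs E z = {(a, b) \<in> E. b = z}"

text \<open>
  The fields are, in this order, the thresholds $l$, $h$, $s$, the candidate sets $A$, $B$, $C$,
  $D$, the sets $X$, $Y$, the forward vertices, the backward vertices, and the traversed arcs.
\<close>

record 'a search =
  lo :: 'a
  hi :: 'a
  soft :: 'a
  setA :: "'a set"
  setB :: "'a set"
  setC :: "'a set"
  setD :: "'a set"
  setX :: "'a set"
  setY :: "'a set"
  fwd :: "'a set"
  bwd :: "'a set"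
  trav :: "'a rel"

datatype 'a config = Searching "'a search" | Cycle_Reported

definition exhausted :: "'a search \<Rightarrow> bool" where
  "exhausted c \<longleftrightarrow> setA c \<union> setB c = {} \<or> setC c \<union> setD c = {}"

fun stopped :: "'a config \<Rightarrow> bool" where
  "stopped (Searching c) \<longleftrightarrow> exhausted c"
| "stopped Cycle_Reported \<longleftrightarrow> True"

definition initial_search :: "'a list \<Rightarrow> 'a \<Rightarrow> 'a \<Rightarrow> 'a search \<Rightarrow> bool" where
  "initial_search L v w c \<longleftrightarrow>
     (\<exists>s. le L w s \<and> le L s v \<and>
        c = \<lparr>lo = w, hi = v, soft = s, setA = {w}, setB = {}, setC = {v}, setD = {},
             setX = {}, setY = {}, fwd = {w}, bwd = {v}, trav = {}\<rparr>)"

definition unreached :: "'a search \<Rightarrow> 'a \<Rightarrow> bool" where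
  "unreached c x \<longleftrightarrow> x \<notin> fwd c \<and> x \<notin> bwd c"

definition chosen :: "'a search \<Rightarrow> 'a \<Rightarrow> 'a \<Rightarrow> bool" where
  "chosen c u z \<longleftrightarrow> \<not> exhausted c \<and> u \<in> setA c \<and> z \<in> setC c"

definition case2f :: "'a list \<Rightarrow> 'a search \<Rightarrow> 'a \<Rightarrow> bool" where
  "case2f L c u \<longleftrightarrow> le L (hi c) u"

definition case2b :: "'a list \<Rightarrow> 'a search \<Rightarrow> 'a \<Rightarrow> bool" where
  "case2b L c z \<longleftrightarrow> le L z (lo c)"

definition case3f :: "'a list \<Rightarrow> 'a search \<Rightarrow> 'a \<Rightarrow> 'a \<Rightarrow> bool" where
  "case3f L c u z \<longleftrightarrow> le L (max_in L z (soft c)) u \<and> lt L u (hi c)"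

definition case3b :: "'a list \<Rightarrow> 'a search \<Rightarrow> 'a \<Rightarrow> 'a \<Rightarrow> bool" where
  "case3b L c u z \<longleftrightarrow> lt L (lo c) z \<and> le L z (min_in L u (soft c))"

definition past2 :: "'a list \<Rightarrow> 'a search \<Rightarrow> 'a \<Rightarrow> 'a \<Rightarrow> bool" where
  "past2 L c u z \<longleftrightarrow> chosen c u z \<and> \<not> case2f L c u \<and> \<not> case2b L c z"

definition past3 :: "'a list \<Rightarrow> 'a search \<Rightarrow> 'a \<Rightarrow> 'a \<Rightarrow> bool" where
  "past3 L c u z \<longleftrightarrow> past2 L c u z \<and> \<not> case3f L c u z \<and> \<not> case3b L c u z"

text \<open>
  One step of the search in the graph \<open>E\<close>, which already contains the new arc. The step
  is nondeterministic: all choices of $u$, $z$, of the new soft threshold and of the traversed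
  arcs are allowed, and so is either of the forward and backward versions of a case if both apply.
  A case with a higher number is used only if no case with a lower number applies to the chosen
  $u$ and $z$. This matters for Case 3: if it could be preferred to Case 2, a search could
  alternate between Cases 3f and 1f forever without ever deleting some $z \le l$. The rules
  \<open>step1f\<close>, \<open>step1b\<close>, \dots are named after the cases.

  In Case 5 both arcs are traversed before the test for a cycle, so $x$ already counts as forward
  and $y$ as backward there; in particular a cycle is reported if $x = y$. Being unreached, on
  the other hand, refers to the situation before the traversal.
\<close>

inductive search_step :: "'a list \<Rightarrow> 'a rel \<Rightarrow> 'a config \<Rightarrow> 'a config \<Rightarrow> bool"
  for L :: "'a list" and E :: "'a rel" where
  step1f: "\<lbrakk>\<not> exhausted c; setA c = {}; a \<in> setB c\<rbrakk> \<Longrightarrow>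
    search_step L E (Searching c)
      (Searching (c\<lparr>setA := setB c, setB := {}, lo := soft c, soft := min_in L a (hi c)\<rparr>))"
| step1b: "\<lbrakk>\<not> exhausted c; setC c = {}; a \<in> setD c\<rbrakk> \<Longrightarrow>
    search_step L E (Searching c)
      (Searching (c\<lparr>setC := setD c, setD := {}, hi := soft c, soft := max_in L a (lo c)\<rparr>))"
| step2f: "\<lbrakk>chosen c u z; case2f L c u\<rbrakk> \<Longrightarrow>
    search_step L E (Searching c) (Searching (c\<lparr>setA := setA c - {u}\<rparr>))"
| step2b: "\<lbrakk>chosen c u z; case2b L c z\<rbrakk> \<Longrightarrow>
    search_step L E (Searching c) (Searching (c\<lparr>setC := setC c - {z}\<rparr>))"
| step3f: "\<lbrakk>past2 L c u z; case3f L c u z\<rbrakk> \<Longrightarrow>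
    search_step L E (Searching c)
      (Searching (c\<lparr>setA := setA c - {u}, setB := insert u (setB c)\<rparr>))"
| step3b: "\<lbrakk>past2 L c u z; case3b L c u z\<rbrakk> \<Longrightarrow>
    search_step L E (Searching c)
      (Searching (c\<lparr>setC := setC c - {z}, setD := insert z (setD c)\<rparr>))"
| step4f: "\<lbrakk>past3 L c u z; out_arcs E u \<subseteq> trav c\<rbrakk> \<Longrightarrow>
    search_step L E (Searching c)
      (Searching (c\<lparr>setA := setA c - {u}, setX := insert u (setX c)\<rparr>))"
| step4b: "\<lbrakk>past3 L c u z; in_arcs E z \<subseteq> trav c\<rbrakk> \<Longrightarrow>
    search_step L E (Searching c)
      (Searching (c\<lparr>setC := setC c - {z}, setY := insert z (setY c)\<rparr>))"
| step5_cycle: "\<lbrakk>past3 L c u z; (u, x) \<in> out_arcs E u - trav c; (y, z) \<in> in_arcs E z - trav c;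
      x \<in> insert y (bwd c) \<or> y \<in> insert x (fwd c)\<rbrakk> \<Longrightarrow>
    search_step L E (Searching c) Cycle_Reported"
| step5: "\<lbrakk>past3 L c u z; (u, x) \<in> out_arcs E u - trav c; (y, z) \<in> in_arcs E z - trav c;
      \<not> (x \<in> insert y (bwd c) \<or> y \<in> insert x (fwd c))\<rbrakk> \<Longrightarrow>
    search_step L E (Searching c)
      (Searching (c\<lparr>trav := trav c \<union> {(u, x), (y, z)},
         fwd := insert x (fwd c), bwd := insert y (bwd c),
         setA := (if unreached c x then insert x (setA c) else setA c),
         setC := (if unreached c y then insert y (setC c) else setC c)\<rparr>))"

definition search_terminates :: "'a list \<Rightarrow> 'a rel \<Rightarrow> 'a config \<Rightarrow> bool" where
  "search_terminates L E k \<longleftrightarrow>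
     (\<nexists>f. f 0 = k \<and> (\<forall>i::nat. search_step L E (f i) (f (Suc i)))) \<and>
     (\<forall>k'. (search_step L E)\<^sup>*\<^sup>* k k' \<and> \<not> stopped k' \<longrightarrow> (\<exists>k''. search_step L E k' k''))"

definition final_threshold :: "'a search \<Rightarrow> 'a" where
  "final_threshold c = (if setA c \<union> setB c = {} then hi c else lo c)"

definition final_X :: "'a list \<Rightarrow> 'a search \<Rightarrow> 'a set" where
  "final_X L c = setX c - {x. le L (final_threshold c) x}"

definition final_Y :: "'a list \<Rightarrow> 'a search \<Rightarrow> 'a set" where
  "final_Y L c = setY c - {y. le L y (final_threshold c)}"

inductive reorder :: "'a list \<Rightarrow> 'a rel \<Rightarrow> 'a search \<Rightarrow> 'a list \<Rightarrow> bool" where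
  "\<lbrakk>X = final_X L c; Y = final_Y L c; s = final_threshold c;
    topological_list X (E \<inter> X \<times> X) OX; topological_list Y (E \<inter> Y \<times> Y) OY;
    filter (\<lambda>x. x \<notin> X \<union> Y) L = P @ s # Q\<rbrakk> \<Longrightarrow>
   reorder L E c (if s \<notin> fwd c then P @ s # OY @ OX @ Q else P @ OY @ OX @ s # Q)"

datatype 'a outcome = Cycle | Order "'a list"

inductive add_arc :: "'a list \<Rightarrow> 'a rel \<Rightarrow> 'a \<Rightarrow> 'a \<Rightarrow> 'a outcome \<Rightarrow> bool" where
  no_search: "lt L v w \<Longrightarrow> add_arc L E v w (Order L)"
| search_cycle: "\<lbrakk>\<not> lt L v w; initial_search L v w c;
      (search_step L (insert (v, w) E))\<^sup>*\<^sup>* (Searching c) Cycle_Reported\<rbrakk> \<Longrightarrow>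
    add_arc L E v w Cycle"
| search_order: "\<lbrakk>\<not> lt L v w; initial_search L v w c;
      (search_step L (insert (v, w) E))\<^sup>*\<^sup>* (Searching c) (Searching c'); exhausted c';
      reorder L (insert (v, w) E) c' L'\<rbrakk> \<Longrightarrow>
    add_arc L E v w (Order L')"

text \<open>
  The orders and graphs that the method can have after some sequence of arc additions, none of
  which has reported a cycle. Arcs are not loops: on a loop, Case 2f or 2b would apply
  immediately and the search would stop without a report.
\<close>

inductive reachable :: "'a set \<Rightarrow> 'a list \<Rightarrow> 'a rel \<Rightarrow> bool" for V :: "'a set" where
  start: "order_list V L \<Longrightarrow> reachable V L {}"
| add: "\<lbrakk>reachable V L E; v \<in> V; w \<in> V; v \<noteq> w; add_arc L E v w (Order L')\<rbrakk> \<Longrightarrow>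
    reachable V L' (insert (v, w) E)"

end

theory Submission
  imports Defs
begin

text \<open>
  When a search stops with final threshold \<open>s\<close>, the trimmed set \<open>X\<close> consists of all forward
  vertices before \<open>s\<close> and \<open>Y\<close> of all backward vertices after \<open>s\<close>, because candidates lie
  within the hard thresholds and are dropped only beyond them. All arcs out of \<open>X\<close> and into \<open>Y\<close>
  have been traversed, so an arc leaves \<open>X\<close> only to a forward vertex at or after \<open>s\<close> and
  enters \<open>Y\<close> only from a backward vertex at or before \<open>s\<close>. Moving \<open>Y\<close> followed by \<open>X\<close> next to
  \<open>s\<close> therefore respects every arc, including the new one, and no cycle exists. Conversely, a report
  exhibits a path from \<open>w\<close> to \<open>v\<close>, which the new arc closes.
\<close>

section \<open>Orders as lists\<close>

lemma before_Nil [simp]: "before [] = {}"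
  by (simp add: before_def)

lemma before_Cons [simp]: "before (x # xs) = {x} \<times> set xs \<union> before xs"
proof -
  have "(a, b) \<in> before (x # xs) \<longleftrightarrow> (a, b) \<in> {x} \<times> set xs \<union> before xs" for a b
  proof
    assume "(a, b) \<in> before (x # xs)"
    then obtain i j where "a = (x # xs) ! i" "b = (x # xs) ! j" "i < j" "j < length (x # xs)"
      by (auto simp: before_def)
    then show "(a, b) \<in> {x} \<times> set xs \<union> before xs"
      by (cases i; cases j) (auto simp: before_def)
  next
    assume "(a, b) \<in> {x} \<times> set xs \<union> before xs"
    then consider "a = x" "b \<in> set xs" | "(a, b) \<in> before xs"
      by auto
    then show "(a, b) \<in> before (x # xs)"
    proof cases
      case 1
      then obtain j where "j < length xs" "b = xs ! j"
        by (auto simp: in_set_conv_nth)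
      with 1 show ?thesis
        unfolding before_def by (intro CollectI exI[of _ 0] exI[of _ "Suc j"]) auto
    next
      case 2
      then obtain i j where "a = xs ! i" "b = xs ! j" "i < j" "j < length xs"
        by (auto simp: before_def)
      then show ?thesis
        unfolding before_def by (intro CollectI exI[of _ "Suc i"] exI[of _ "Suc j"]) auto
    qed
  qed
  then show ?thesis
    by auto
qed

lemma before_append [simp]: "before (xs @ ys) = before xs \<union> before ys \<union> set xs \<times> set ys"
  by (induction xs) auto

lemma before_filter: "before (filter P xs) = before xs \<inter> Collect P \<times> Collect P"
  by (induction xs) auto

lemma before_subset: "before xs \<subseteq> set xs \<times> set xs"
  by (induction xs) auto

text \<open>Turns order comparisons into arithmetic. A vertex absent from the list gets the position
  \<open>length xs\<close>, which is why the lemmas below ask for membership.\<close>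

definition pos :: "'a list \<Rightarrow> 'a \<Rightarrow> nat" where
  "pos xs x = length (takeWhile (\<lambda>y. y \<noteq> x) xs)"

lemma before_iff_pos:
  "distinct xs \<Longrightarrow> (x, y) \<in> before xs \<longleftrightarrow> x \<in> set xs \<and> y \<in> set xs \<and> pos xs x < pos xs y"
  by (induction xs) (auto simp: pos_def)

lemma pos_eq_iff:
  "x \<in> set xs \<Longrightarrow> y \<in> set xs \<Longrightarrow> pos xs x = pos xs y \<longleftrightarrow> x = y"
  by (induction xs) (auto simp: pos_def)

text \<open>For a duplicate-free list, trichotomy of positions makes \<open>before L\<close> a
  strict linear order, so only the arc condition remains to be checked.\<close>

lemma topological_list_iff:
  "topological_list V E L \<longleftrightarrow> distinct L \<and> set L = V \<and> E \<subseteq> before L"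
proof -
  have "strict_linear_order_on (set L) (before L)" if "distinct L"
    using that pos_eq_iff[of _ L]
    unfolding strict_linear_order_on_def trans_on_def irrefl_def total_on_def
    by (auto simp: before_iff_pos) (meson nat_neq_iff)
  then show ?thesis
    using before_subset[of L]
    by (auto simp: topological_list_def topological_order_def order_list_def)
qed

text \<open>A transitive irreflexive relation is its own transitive closure, so it has no cycle, and
  neither has any subset of it.\<close>

lemma acyclic_if_topological_list:
  assumes "topological_list V E L"
  shows "acyclic E"
proof -
  have "trans (before L)" "irrefl (before L)" "E \<subseteq> before L"
    using assms by (auto simp: topological_list_def topological_order_def strict_linear_order_on_def)
  then show ?thesis
    by (metis acyclic_irrefl acyclic_subset trancl_id)
qed

lemma lt_iff_pos:
  "distinct L \<Longrightarrow> x \<in> set L \<Longrightarrow> y \<in> set L \<Longrightarrow> lt L x y \<longleftrightarrow> pos L x < pos L y"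
  by (simp add: lt_def before_iff_pos)

lemma le_iff_pos:
  "distinct L \<Longrightarrow> x \<in> set L \<Longrightarrow> y \<in> set L \<Longrightarrow> le L x y \<longleftrightarrow> pos L x \<le> pos L y"
  using pos_eq_iff[of x L y] by (auto simp: le_def lt_iff_pos)

lemma pos_min_in:
  "distinct L \<Longrightarrow> x \<in> set L \<Longrightarrow> y \<in> set L \<Longrightarrow> pos L (min_in L x y) = min (pos L x) (pos L y)"
  by (auto simp: min_in_def le_iff_pos)

lemma pos_max_in:
  "distinct L \<Longrightarrow> x \<in> set L \<Longrightarrow> y \<in> set L \<Longrightarrow> pos L (max_in L x y) = max (pos L x) (pos L y)"
  by (auto simp: max_in_def le_iff_pos)

section \<open>Invariants of the search\<close>

text \<open>One insertion that starts a search: \<open>E\<close> is the graph without the new arc,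
  still ordered by \<open>L\<close>.\<close>

locale arc_insertion =
  fixes V :: "'a set" and L :: "'a list" and E :: "'a rel" and v w :: 'a
  assumes topological: "topological_list V E L"
    and v_in [simp]: "v \<in> V" and w_in [simp]: "w \<in> V" and v_neq_w: "v \<noteq> w"
    and not_lt: "\<not> lt L v w"
begin

abbreviation E' :: "'a rel" where
  "E' \<equiv> insert (v, w) E"

abbreviation p :: "'a \<Rightarrow> nat" where
  "p \<equiv> pos L"

lemma distinct_L: "distinct L" and set_L: "set L = V" and E_before: "E \<subseteq> before L"
  using topological by (auto simp: topological_list_iff)

lemma finite_V: "finite V"
  using set_L by auto

lemma lt_iff: "x \<in> V \<Longrightarrow> y \<in> V \<Longrightarrow> lt L x y \<longleftrightarrow> p x < p y"
  and le_iff: "x \<in> V \<Longrightarrow> y \<in> V \<Longrightarrow> le L x y \<longleftrightarrow> p x \<le> p y"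
  and p_min_in: "x \<in> V \<Longrightarrow> y \<in> V \<Longrightarrow> p (min_in L x y) = min (p x) (p y)"
  and p_max_in: "x \<in> V \<Longrightarrow> y \<in> V \<Longrightarrow> p (max_in L x y) = max (p x) (p y)"
  and p_eq_iff: "x \<in> V \<Longrightarrow> y \<in> V \<Longrightarrow> p x = p y \<longleftrightarrow> x = y"
  using distinct_L set_L by (simp_all add: lt_iff_pos le_iff_pos pos_min_in pos_max_in pos_eq_iff)

lemma min_in_V [simp]: "x \<in> V \<Longrightarrow> y \<in> V \<Longrightarrow> min_in L x y \<in> V"
  and max_in_V [simp]: "x \<in> V \<Longrightarrow> y \<in> V \<Longrightarrow> max_in L x y \<in> V"
  by (auto simp: min_in_def max_in_def)

lemma arcD: "(x, y) \<in> E \<Longrightarrow> x \<in> V \<and> y \<in> V \<and> p x < p y"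
  using subsetD[OF E_before, of "(x, y)"] set_L before_iff_pos[OF distinct_L, of x y] by simp

lemma arc'_in_V: "(x, y) \<in> E' \<Longrightarrow> x \<in> V \<and> y \<in> V"
  using arcD by auto

lemma finite_E': "finite E'"
proof (rule finite_subset)
  show "E' \<subseteq> V \<times> V"
  proof (rule subrelI)
    fix x y
    assume "(x, y) \<in> E'"
    from arc'_in_V[OF this] show "(x, y) \<in> V \<times> V"
      by simp
  qed
  show "finite (V \<times> V)"
    using finite_V by simp
qed

lemma p_w_less_p_v: "p w < p v"
  using not_lt v_neq_w p_eq_iff[of v w] by (simp add: lt_iff)

text \<open>The order-free part of the invariant. As \<open>fwd c\<close> and \<open>bwd c\<close>
  are disjoint, the clause on \<open>trav c\<close> makes a traversed arc with forward tail end in a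
  forward vertex, and one with backward head start in a backward vertex.\<close>

definition reach_inv :: "'a search \<Rightarrow> bool" where
  "reach_inv c \<longleftrightarrow>
     w \<in> fwd c \<and> v \<in> bwd c \<and> fwd c \<inter> bwd c = {} \<and> fwd c \<subseteq> V \<and> bwd c \<subseteq> V \<and>
     (\<forall>x \<in> fwd c. (w, x) \<in> E'\<^sup>*) \<and> (\<forall>y \<in> bwd c. (y, v) \<in> E'\<^sup>*) \<and>
     setA c \<union> setB c \<union> setX c \<subseteq> fwd c \<and> setC c \<union> setD c \<union> setY c \<subseteq> bwd c \<and>
     trav c \<subseteq> fwd c \<times> fwd c \<union> bwd c \<times> bwd c \<and>
     (\<forall>x \<in> setX c. out_arcs E' x \<subseteq> trav c) \<and> (\<forall>y \<in> setY c. in_arcs E' y \<subseteq> trav c)"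

text \<open>The last two clauses concern vertices dropped by Case 2: they lie beyond a hard
  threshold and stay there, because \<open>lo\<close> never moves down and \<open>hi\<close> never
  moves up. The strict bounds on \<open>setB\<close> and \<open>setD\<close> are what termination
  needs in Case 1.\<close>

definition threshold_inv :: "'a search \<Rightarrow> bool" where
  "threshold_inv c \<longleftrightarrow>
     lo c \<in> V \<and> hi c \<in> V \<and> soft c \<in> V \<and> p (lo c) \<le> p (soft c) \<and> p (soft c) \<le> p (hi c) \<and>
     (\<forall>x \<in> setA c. p (lo c) \<le> p x) \<and> (\<forall>x \<in> setB c. p (soft c) \<le> p x \<and> p (lo c) < p x) \<and>
     (\<forall>y \<in> setC c. p y \<le> p (hi c)) \<and> (\<forall>y \<in> setD c. p y \<le> p (soft c) \<and> p y < p (hi c)) \<and>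
     (\<forall>x \<in> fwd c - (setA c \<union> setB c \<union> setX c). p (hi c) \<le> p x) \<and>
     (\<forall>y \<in> bwd c - (setC c \<union> setD c \<union> setY c). p y \<le> p (lo c))"

fun config_inv :: "'a config \<Rightarrow> bool" where
  "config_inv (Searching c) \<longleftrightarrow> reach_inv c \<and> threshold_inv c"
| "config_inv Cycle_Reported \<longleftrightarrow> \<not> acyclic E'"

lemma initial_inv: "initial_search L v w c \<Longrightarrow> config_inv (Searching c)"
proof -
  assume "initial_search L v w c"
  then obtain s where s: "le L w s" "le L s v"
    and c: "c = \<lparr>lo = w, hi = v, soft = s, setA = {w}, setB = {}, setC = {v}, setD = {},
             setX = {}, setY = {}, fwd = {w}, bwd = {v}, trav = {}\<rparr>"
    by (auto simp: initial_search_def)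
  have "s \<in> V"
    using s(1) before_subset[of L] w_in unfolding set_L le_def lt_def by blast
  with s v_neq_w show ?thesis
    by (auto simp: reach_inv_def threshold_inv_def c le_iff)
qed

lemma in_V:
  assumes "reach_inv c" "threshold_inv c"
  shows "lo c \<in> V" "hi c \<in> V" "soft c \<in> V"
    "x \<in> setA c \<Longrightarrow> x \<in> V" "x \<in> setB c \<Longrightarrow> x \<in> V" "x \<in> setC c \<Longrightarrow> x \<in> V" "x \<in> setD c \<Longrightarrow> x \<in> V"
  using assms by (auto simp: reach_inv_def threshold_inv_def)

lemma past2D:
  assumes "past2 L c u z" "reach_inv c" "threshold_inv c"
  shows "u \<in> setA c" "z \<in> setC c" "u \<in> V" "z \<in> V" "p u < p (hi c)" "p (lo c) < p z"
  using assms in_V[OF assms(2,3)]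
  by (auto simp: past2_def chosen_def case2f_def case2b_def le_iff)

text \<open>\<open>u\<close> is forward and \<open>v\<close> backward, so they differ; likewise
  \<open>z\<close> and \<open>w\<close>. Hence Case 5 never traverses the new arc.\<close>

lemma past3D:
  assumes "past3 L c u z" "reach_inv c" "threshold_inv c"
  shows "u \<in> setA c" "z \<in> setC c" "u \<in> V" "z \<in> V" "p u < p (hi c)" "p (lo c) < p z" "u \<noteq> v" "z \<noteq> w"
proof -
  have 2: "past2 L c u z"
    using assms(1) by (simp add: past3_def)
  note past2D[OF 2 assms(2,3)]
  then show "u \<in> setA c" "z \<in> setC c" "u \<in> V" "z \<in> V" "p u < p (hi c)" "p (lo c) < p z" "u \<noteq> v" "z \<noteq> w"
    using assms(2) by (auto simp: reach_inv_def)
qed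

text \<open>The traversed arcs are old and so go up in \<open>L\<close>: \<open>x\<close> lies above
  \<open>u\<close>, hence not below \<open>lo c\<close>, and \<open>y\<close> lies below
  \<open>z\<close>, hence not above \<open>hi c\<close>.\<close>

lemma traversal:
  assumes "past3 L c u z" "reach_inv c" "threshold_inv c"
    and "(u, x) \<in> out_arcs E' u - trav c" "(y, z) \<in> in_arcs E' z - trav c"
  shows "(u, x) \<in> E" "(y, z) \<in> E" "(w, u) \<in> E'\<^sup>*" "(z, v) \<in> E'\<^sup>*" "(w, x) \<in> E'\<^sup>*" "(y, v) \<in> E'\<^sup>*"
    "u \<in> fwd c" "z \<in> bwd c" "x \<in> V" "y \<in> V" "p (lo c) \<le> p x" "p y \<le> p (hi c)"
proof -
  note u = past3D[OF assms(1-3)]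
  show E: "(u, x) \<in> E" "(y, z) \<in> E"
    using assms(4,5) u by (auto simp: out_arcs_def in_arcs_def)
  show f: "u \<in> fwd c" "z \<in> bwd c"
    using u assms(2) by (auto simp: reach_inv_def)
  then show reach: "(w, u) \<in> E'\<^sup>*" "(z, v) \<in> E'\<^sup>*"
    using assms(2) by (auto simp: reach_inv_def)
  show "(w, x) \<in> E'\<^sup>*" "(y, v) \<in> E'\<^sup>*"
    using reach E by (auto intro: rtrancl_into_rtrancl converse_rtrancl_into_rtrancl)
  show "x \<in> V" "y \<in> V"
    using E arcD by auto
  have "p (lo c) \<le> p u" "p z \<le> p (hi c)"
    using u assms(3) by (auto simp: threshold_inv_def)
  then show "p (lo c) \<le> p x" "p y \<le> p (hi c)"
    using E arcD by fastforce+
qed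

lemma not_acyclic_if_path: "(w, v) \<in> E'\<^sup>* \<Longrightarrow> \<not> acyclic E'"
  by (auto simp: acyclic_def intro: rtrancl_into_trancl1)

lemma step_inv:
  assumes "search_step L E' k k'" "config_inv k"
  shows "config_inv k'"
  using assms
proof (induction rule: search_step.induct)
  case (step1f c a)
  then have inv: "reach_inv c" "threshold_inv c"
    by auto
  note V = in_V[OF inv]
  have a: "a \<in> V" "p (soft c) \<le> p a"
    using step1f.hyps inv V by (auto simp: threshold_inv_def)
  \<comment> \<open>\<open>setD\<close> lies at or below the old soft threshold and
    \<open>setB\<close> at or above it, so a new one drawn from \<open>setB\<close> still bounds
    \<open>setD\<close>.\<close>
  have "p y \<le> p a" if "y \<in> setD c" for y
    using inv(2) that a(2) by (auto simp: threshold_inv_def intro: order_trans)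
  moreover have "p y \<le> p (soft c)" if "y \<in> bwd c - (setC c \<union> setD c \<union> setY c)" for y
    using inv(2) that by (auto simp: threshold_inv_def intro: order_trans)
  ultimately show ?case
    using inv step1f.hyps V a by (auto simp: reach_inv_def threshold_inv_def p_min_in)
next
  case (step1b c a)
  then have inv: "reach_inv c" "threshold_inv c"
    by auto
  note V = in_V[OF inv]
  have a: "a \<in> V" "p a \<le> p (soft c)"
    using step1b.hyps inv V by (auto simp: threshold_inv_def)
  have "p a \<le> p x" if "x \<in> setB c" for x
    using inv(2) that a(2) by (auto simp: threshold_inv_def intro: order_trans)
  moreover have "p (soft c) \<le> p x" if "x \<in> fwd c - (setA c \<union> setB c \<union> setX c)" for x
    using inv(2) that by (auto simp: threshold_inv_def intro: order_trans)
  ultimately show ?case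
    using inv step1b.hyps V a by (auto simp: reach_inv_def threshold_inv_def p_max_in)
next
  case (step2f c u z)
  then have inv: "reach_inv c" "threshold_inv c"
    by auto
  note V = in_V[OF inv]
  have "p (hi c) \<le> p u"
    using V step2f.hyps by (simp add: case2f_def le_iff chosen_def)
  with inv show ?case
    by (auto simp: reach_inv_def threshold_inv_def)
next
  case (step2b c u z)
  then have inv: "reach_inv c" "threshold_inv c"
    by auto
  note V = in_V[OF inv]
  have "p z \<le> p (lo c)"
    using V step2b.hyps by (simp add: case2b_def le_iff chosen_def)
  with inv show ?case
    by (auto simp: reach_inv_def threshold_inv_def)
next
  case (step3f c u z)
  then have inv: "reach_inv c" "threshold_inv c"
    by auto
  note V = in_V[OF inv] past2D[OF step3f.hyps(1) inv]
  \<comment> \<open>Past Case 2, \<open>z\<close> is above \<open>lo c\<close>, and Case 3f puts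
    \<open>u\<close> at or above \<open>z\<close>; this gives the strict bound for
    \<open>setB\<close>.\<close>
  have "p (soft c) \<le> p u" "p (lo c) < p u"
    using V step3f.hyps(2) by (auto simp: case3f_def le_iff p_max_in)
  with inv V show ?case
    by (auto simp: reach_inv_def threshold_inv_def)
next
  case (step3b c u z)
  then have inv: "reach_inv c" "threshold_inv c"
    by auto
  note V = in_V[OF inv] past2D[OF step3b.hyps(1) inv]
  have "p z \<le> p (soft c)" "p z < p (hi c)"
    using V step3b.hyps(2) by (auto simp: case3b_def le_iff p_min_in)
  with inv V show ?case
    by (auto simp: reach_inv_def threshold_inv_def)
next
  case (step4f c u z)
  then have inv: "reach_inv c" "threshold_inv c"
    by auto
  with step4f.hyps past3D[OF step4f.hyps(1) inv] show ?case
    by (auto simp: reach_inv_def threshold_inv_def)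
next
  case (step4b c u z)
  then have inv: "reach_inv c" "threshold_inv c"
    by auto
  with step4b.hyps past3D[OF step4b.hyps(1) inv] show ?case
    by (auto simp: reach_inv_def threshold_inv_def)
next
  case (step5_cycle c u z x y)
  then have inv: "reach_inv c" "threshold_inv c"
    by auto
  note t = traversal[OF step5_cycle.hyps(1) inv step5_cycle.hyps(2,3)]
  \<comment> \<open>A report means \<open>x = y\<close>, \<open>x\<close> backward or
    \<open>y\<close> forward. In each case \<open>x\<close> or \<open>y\<close> is both reached from
    \<open>w\<close> and able to reach \<open>v\<close>.\<close>
  have "(w, x) \<in> E'\<^sup>* \<and> (x, v) \<in> E'\<^sup>* \<or> (w, y) \<in> E'\<^sup>* \<and> (y, v) \<in> E'\<^sup>*"
    using step5_cycle.hyps(4) t inv(1) by (auto simp: reach_inv_def)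
  then have "(w, v) \<in> E'\<^sup>*"
    by (auto intro: rtrancl_trans)
  then show ?case
    unfolding config_inv.simps by (rule not_acyclic_if_path)
next
  case (step5 c u z x y)
  then have inv: "reach_inv c" "threshold_inv c"
    by auto
  note t = traversal[OF step5.hyps(1) inv step5.hyps(2,3)]
  let ?c = "c\<lparr>trav := trav c \<union> {(u, x), (y, z)},
         fwd := insert x (fwd c), bwd := insert y (bwd c),
         setA := (if unreached c x then insert x (setA c) else setA c),
         setC := (if unreached c y then insert y (setC c) else setC c)\<rparr>"
  \<comment> \<open>The enlarged \<open>fwd\<close> and \<open>bwd\<close> stay disjoint by the
    negated report condition.\<close>
  have "reach_inv ?c"
    unfolding reach_inv_def
    by (intro conjI; use inv(1) t step5.hyps(4) in \<open>simp add: reach_inv_def unreached_def; blast\<close>)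
  moreover have "threshold_inv ?c"
    using inv(2) t step5.hyps(4) unfolding threshold_inv_def by (auto simp: unreached_def)
  ultimately show ?case
    by simp
qed

lemma steps_inv: "(search_step L E')\<^sup>*\<^sup>* k k' \<Longrightarrow> config_inv k \<Longrightarrow> config_inv k'"
  by (induction rule: rtranclp_induct) (auto intro: step_inv)

section \<open>Termination of the search\<close>

text \<open>
  Cases 2, 4 and 5 decrease the first two components, Case 3 the last one. Case 1f either raises
  \<open>lo\<close>, or moves \<open>soft\<close> strictly between \<open>lo\<close> and \<open>hi\<close>, or moves a vertex above \<open>hi\<close> from
  \<open>setB\<close> into \<open>setA\<close>, from where it never returns; symmetrically for Case 1b.
\<close>

definition soft_count :: "'a search \<Rightarrow> nat" where
  "soft_count c = of_bool (p (soft c) = p (lo c) \<or> p (soft c) = p (hi c)) +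
     of_bool (\<exists>x \<in> setB c. p (hi c) \<le> p x) + of_bool (\<exists>y \<in> setD c. p y \<le> p (lo c))"

definition search_measures :: "('a search \<Rightarrow> nat) list" where
  "search_measures =
     [\<lambda>c. card (E' - trav c),
      \<lambda>c. card (setA c) + card (setB c) + card (setC c) + card (setD c),
      \<lambda>c. 3 * (p (hi c) - p (lo c)) + soft_count c,
      \<lambda>c. card (setA c) + card (setC c)]"

lemma finite_sets:
  assumes "reach_inv c"
  shows "finite (setA c)" "finite (setB c)" "finite (setC c)" "finite (setD c)"
proof -
  have "finite (fwd c)" "finite (bwd c)"
    using assms finite_V by (auto simp: reach_inv_def intro: finite_subset)
  then show "finite (setA c)" "finite (setB c)" "finite (setC c)" "finite (setD c)"
    using assms by (auto simp: reach_inv_def intro: finite_subset)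
qed

lemma step_decreases:
  assumes "search_step L E' (Searching c) (Searching c')" "reach_inv c" "threshold_inv c"
  shows "(c', c) \<in> measures search_measures"
proof -
  note V = in_V[OF assms(2,3)]
  note fin = finite_sets[OF assms(2)]
  have le: "p (lo c) \<le> p (soft c)" "p (soft c) \<le> p (hi c)"
    using assms(3) by (auto simp: threshold_inv_def)
  show ?thesis
    using assms(1)
  proof cases
    case (step1f a)
    then have a: "a \<in> V" "p (soft c) \<le> p a" "p (lo c) < p a"
      using assms(3) V by (auto simp: threshold_inv_def)
    have "3 * (p (hi c') - p (lo c')) + soft_count c' < 3 * (p (hi c) - p (lo c)) + soft_count c"
    \<comment> \<open>If \<open>soft\<close> coincides with \<open>lo\<close>, the gap between the
      hard thresholds is unchanged, so an indicator in \<open>soft_count\<close> has to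
      fall.\<close>
    proof (cases "p (lo c) = p (soft c)")
      case True
      have "soft_count c' < soft_count c"
      \<comment> \<open>If \<open>a\<close> is below \<open>hi c\<close>, the new soft threshold is
        strictly inside and the first indicator falls. Otherwise \<open>a\<close> witnessed the
        second one, which falls because \<open>setB\<close> becomes empty.\<close>
      proof (cases "p a < p (hi c)")
        case lt: True
        then show ?thesis
          using True step1f a V by (simp add: soft_count_def p_min_in)
      next
        case False
        then have "\<exists>x \<in> setB c. p (hi c) \<le> p x"
          using step1f(4) by (intro bexI[of _ a]) auto
        then show ?thesis
          using True False step1f a V by (simp add: soft_count_def p_min_in)
      qed
      then show ?thesis
        using True step1f by simp
    next
      case False
      \<comment> \<open>\<open>setB c'\<close> is empty, so at most two indicators hold; the weight
        3 lets the shrinking gap outweigh them.\<close>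
      have "soft_count c' \<le> 2"
        using step1f by (simp add: soft_count_def of_bool_def)
      then show ?thesis
        using False step1f le by simp
    qed
    \<comment> \<open>\<open>setA c\<close> was empty, so replacing it by \<open>setB c\<close>
      keeps the second component.\<close>
    then show ?thesis
      using step1f by (simp add: search_measures_def)
  next
    case (step1b a)
    then have a: "a \<in> V" "p a \<le> p (soft c)" "p a < p (hi c)"
      using assms(3) V by (auto simp: threshold_inv_def)
    have "3 * (p (hi c') - p (lo c')) + soft_count c' < 3 * (p (hi c) - p (lo c)) + soft_count c"
    proof (cases "p (hi c) = p (soft c)")
      case True
      have "soft_count c' < soft_count c"
      proof (cases "p (lo c) < p a")
        case lt: True
        then show ?thesis
          using True step1b a V by (simp add: soft_count_def p_max_in)
      next
        case False
        then have "\<exists>y \<in> setD c. p y \<le> p (lo c)"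
          using step1b(4) by (intro bexI[of _ a]) auto
        then show ?thesis
          using True False step1b a V by (simp add: soft_count_def p_max_in)
      qed
      then show ?thesis
        using True step1b by simp
    next
      case False
      have "soft_count c' \<le> 2"
        using step1b by (simp add: soft_count_def of_bool_def)
      then show ?thesis
        using False step1b le by simp
    qed
    then show ?thesis
      using step1b by (simp add: search_measures_def)
  next
    case (step2f u z)
    then have "card (setA c') < card (setA c)"
      using card_Diff1_less[OF fin(1), of u] by (simp add: chosen_def)
    then show ?thesis
      using step2f by (simp add: search_measures_def)
  next
    case (step2b u z)
    then have "card (setC c') < card (setC c)"
      using card_Diff1_less[OF fin(3), of z] by (simp add: chosen_def)
    then show ?thesis
      using step2b by (simp add: search_measures_def)
  next
    case (step3f u z)
    note u = past2D[OF step3f(2) assms(2,3)]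
    have "card (setA c) = Suc (card (setA c'))"
      using card_Suc_Diff1[OF fin(1) u(1)] step3f(1) by simp
    moreover have "card (setB c') \<le> Suc (card (setB c))"
      using fin step3f(1) by (simp add: card_insert_if)
    \<comment> \<open>As \<open>u\<close> lies below \<open>hi c\<close>, putting it into
      \<open>setB\<close> gives the second indicator no new witness.\<close>
    moreover have "soft_count c' = soft_count c"
      using step3f(1) u by (auto simp: soft_count_def)
    ultimately show ?thesis
      using step3f(1) by (simp add: search_measures_def) linarith
  next
    case (step3b u z)
    note u = past2D[OF step3b(2) assms(2,3)]
    have "card (setC c) = Suc (card (setC c'))"
      using card_Suc_Diff1[OF fin(3) u(2)] step3b(1) by simp
    moreover have "card (setD c') \<le> Suc (card (setD c))"
      using fin step3b(1) by (simp add: card_insert_if)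
    moreover have "soft_count c' = soft_count c"
      using step3b(1) u by (auto simp: soft_count_def)
    ultimately show ?thesis
      using step3b(1) by (simp add: search_measures_def) linarith
  next
    case (step4f u z)
    then have "card (setA c') < card (setA c)"
      using card_Diff1_less[OF fin(1), of u] past3D[OF step4f(2) assms(2,3)] by simp
    then show ?thesis
      using step4f by (simp add: search_measures_def)
  next
    case (step4b u z)
    then have "card (setC c') < card (setC c)"
      using card_Diff1_less[OF fin(3), of z] past3D[OF step4b(2) assms(2,3)] by simp
    then show ?thesis
      using step4b by (simp add: search_measures_def)
  next
    case (step5 u z x y)
    have "E' - trav c' \<subset> E' - trav c"
      using step5 by (auto simp: out_arcs_def)
    then have "card (E' - trav c') < card (E' - trav c)"
      using finite_E' by (intro psubset_card_mono) auto
    then show ?thesis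
      by (simp add: search_measures_def)
  qed
qed

lemma wf_search: "wf {(k', k). config_inv k \<and> search_step L E' k k'}" (is "wf ?R")
proof (rule wf_subset)
  \<comment> \<open>\<open>Cycle_Reported\<close> is ranked 0 and every \<open>Searching c\<close>
    is shifted by \<open>Suc\<close>, so a report always decreases the measure.\<close>
  let ?lift = "\<lambda>f. case_config (\<lambda>c. Suc (f c)) 0"
  show "wf (measures (map ?lift search_measures))"
    by simp
  show "?R \<subseteq> measures (map ?lift search_measures)"
  proof (rule subrelI)
    fix k' k
    assume "(k', k) \<in> ?R"
    then have step: "search_step L E' k k'" and inv: "config_inv k"
      by auto
    then obtain c where k: "k = Searching c"
      by (cases rule: search_step.cases) auto
    show "(k', k) \<in> measures (map ?lift search_measures)"
    proof (cases k')
      case (Searching c')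
      have "(c', c) \<in> measures search_measures"
        using step_decreases step inv k Searching by simp
      then show ?thesis
        by (simp add: k Searching search_measures_def)
    qed (simp add: k search_measures_def)
  qed
qed

lemma progress:
  assumes "\<not> stopped k"
  shows "\<exists>k'. search_step L E' k k'"
proof -
  obtain c where k: "k = Searching c" and c: "\<not> exhausted c"
    using assms by (cases k) auto
  show ?thesis
  proof (cases "setA c = {} \<or> setC c = {}")
    case True
    then consider a where "setA c = {}" "a \<in> setB c" | a where "setC c = {}" "a \<in> setD c"
      using c by (auto simp: exhausted_def)
    then show ?thesis
      using search_step.step1f[OF c] search_step.step1b[OF c] k by cases blast+
  next
    case False
    then obtain u z where uz: "chosen c u z"
      using c by (auto simp: chosen_def)
    then consider "case2f L c u" | "case2b L c z" | "past2 L c u z" "case3f L c u z"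
      | "past2 L c u z" "case3b L c u z" | "past3 L c u z"
      by (auto simp: past2_def past3_def)
    then show ?thesis
    proof cases
      case 5
      show ?thesis
      proof (cases "out_arcs E' u \<subseteq> trav c \<or> in_arcs E' z \<subseteq> trav c")
        case True
        then show ?thesis
          using search_step.step4f[OF 5] search_step.step4b[OF 5] k by blast
      next
        case False
        then obtain x y where "(u, x) \<in> out_arcs E' u - trav c" "(y, z) \<in> in_arcs E' z - trav c"
          by (auto simp: out_arcs_def in_arcs_def)
        \<comment> \<open>The two rules for Case 5 have complementary side conditions, so one of
          them applies.\<close>
        from search_step.step5_cycle[OF 5 this] search_step.step5[OF 5 this] show ?thesis
          unfolding k by blast
      qed
    qed (use uz k in \<open>blast intro: search_step.intros\<close>)+
  qed
qed

lemma search_terminates: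
  assumes "config_inv k"
  shows "search_terminates L E' k"
proof -
  have "\<nexists>f. f 0 = k \<and> (\<forall>i::nat. search_step L E' (f i) (f (Suc i)))"
  proof
    assume "\<exists>f. f 0 = k \<and> (\<forall>i::nat. search_step L E' (f i) (f (Suc i)))"
    then obtain f where f: "f 0 = k" "\<And>i::nat. search_step L E' (f i) (f (Suc i))"
      by auto
    have "config_inv (f i)" for i
      by (induction i) (use f assms step_inv in auto)
    then show False
      using f(2) wf_search unfolding wf_iff_no_infinite_down_chain by blast
  qed
  then show ?thesis
    using progress by (auto simp: search_terminates_def)
qed

text \<open>Well-founded induction and progress yield a complete run, from which every insertion
  gets an outcome.\<close>

lemma search_stops:
  assumes "config_inv k"
  shows "\<exists>k'. (search_step L E')\<^sup>*\<^sup>* k k' \<and> stopped k'"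
  using wf_search assms
proof (induction k rule: wf_induct_rule)
  case (less k)
  show ?case
  proof (cases "stopped k")
    case False
    then obtain k' where k': "search_step L E' k k'"
      using progress by blast
    then obtain k'' where "(search_step L E')\<^sup>*\<^sup>* k' k''" "stopped k''"
      using less.IH[of k'] less.prems step_inv by blast
    with k' show ?thesis
      by (meson converse_rtranclp_into_rtranclp)
  qed auto
qed

section \<open>Reordering\<close>

lemma final_sets:
  assumes "reach_inv c" "threshold_inv c" "exhausted c"
  shows "final_threshold c \<in> V"
    and "final_X L c = {x \<in> fwd c. p x < p (final_threshold c)}"
    and "final_Y L c = {y \<in> bwd c. p (final_threshold c) < p y}"
    and "final_X L c \<subseteq> setX c" and "final_Y L c \<subseteq> setY c"
proof -
  let ?s = "final_threshold c"
  show s: "?s \<in> V"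
    using in_V[OF assms(1,2)] by (simp add: final_threshold_def)
  show "final_X L c \<subseteq> setX c" "final_Y L c \<subseteq> setY c"
    by (auto simp: final_X_def final_Y_def)
  have V: "setX c \<subseteq> V" "setY c \<subseteq> V" "setX c \<subseteq> fwd c" "setY c \<subseteq> bwd c"
    using assms(1) by (auto simp: reach_inv_def)
  have le: "p (lo c) \<le> p (soft c)" "p (soft c) \<le> p (hi c)"
    using assms(2) by (auto simp: threshold_inv_def)
  have bounds: "\<And>x. x \<in> setA c \<union> setB c \<Longrightarrow> p (lo c) \<le> p x"
    "\<And>x. x \<in> fwd c - (setA c \<union> setB c \<union> setX c) \<Longrightarrow> p (hi c) \<le> p x"
    "\<And>y. y \<in> setC c \<union> setD c \<Longrightarrow> p y \<le> p (hi c)"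
    "\<And>y. y \<in> bwd c - (setC c \<union> setD c \<union> setY c) \<Longrightarrow> p y \<le> p (lo c)"
    using assms(2) by (auto simp: threshold_inv_def intro: less_imp_le)
  have stop: "setA c \<union> setB c = {} \<and> ?s = hi c \<or> setC c \<union> setD c = {} \<and> ?s = lo c"
    using assms(3) by (auto simp: exhausted_def final_threshold_def)
  \<comment> \<open>A forward vertex outside \<open>setX c\<close> is a candidate or was dropped.
    Dropped ones are not below \<open>hi c\<close>; forward candidates remain only if the threshold
    is \<open>lo c\<close>, and they are not below that.\<close>
  have X: "x \<in> setX c" if "x \<in> fwd c" "p x < p ?s" for x
    using stop
  proof (elim disjE conjE)
    assume "setA c \<union> setB c = {}" "?s = hi c"
    then show ?thesis
      using bounds(2)[of x] that by force
  next
    assume "setC c \<union> setD c = {}" "?s = lo c"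
    then show ?thesis
      using bounds(1,2)[of x] le that by force
  qed
  have Y: "y \<in> setY c" if "y \<in> bwd c" "p ?s < p y" for y
    using stop
  proof (elim disjE conjE)
    assume "setA c \<union> setB c = {}" "?s = hi c"
    then show ?thesis
      using bounds(3,4)[of y] le that by force
  next
    assume "setC c \<union> setD c = {}" "?s = lo c"
    then show ?thesis
      using bounds(4)[of y] that by force
  qed
  show "final_X L c = {x \<in> fwd c. p x < p ?s}" "final_Y L c = {y \<in> bwd c. p ?s < p y}"
    using X Y V s by (auto simp: final_X_def final_Y_def le_iff subset_iff not_le)
qed

text \<open>All arcs out of \<open>final_X\<close> and into \<open>final_Y\<close> have been
  traversed, and a traversed arc never joins a forward and a backward vertex.\<close>

lemma final_arcs:
  assumes "reach_inv c" "threshold_inv c" "exhausted c" and arc: "(a, b) \<in> E'"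
  shows "a \<in> final_X L c \<Longrightarrow> b \<in> fwd c" "b \<in> final_Y L c \<Longrightarrow> a \<in> bwd c"
proof -
  note final = final_sets[OF assms(1-3)]
  have trav: "trav c \<subseteq> fwd c \<times> fwd c \<union> bwd c \<times> bwd c" and disj: "fwd c \<inter> bwd c = {}"
    using assms(1) by (auto simp: reach_inv_def)
  show "b \<in> fwd c" if a: "a \<in> final_X L c"
  proof -
    have "out_arcs E' a \<subseteq> trav c" "a \<in> fwd c"
      using a final(2,4) assms(1) by (auto simp: reach_inv_def)
    moreover have "(a, b) \<in> out_arcs E' a"
      using arc by (simp add: out_arcs_def)
    ultimately show ?thesis
      using trav disj by blast
  qed
  show "a \<in> bwd c" if b: "b \<in> final_Y L c"
  proof -
    have "in_arcs E' b \<subseteq> trav c" "b \<in> bwd c"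
      using b final(3,5) assms(1) by (auto simp: reach_inv_def)
    moreover have "(a, b) \<in> in_arcs E' b"
      using arc by (simp add: in_arcs_def)
    ultimately show ?thesis
      using trav disj by blast
  qed
qed

lemma reorder_topological:
  assumes inv: "reach_inv c" "threshold_inv c" and ex: "exhausted c"
    and reorder: "reorder L E' c L'"
  shows "topological_list V E' L'"
  using reorder
proof cases
  case (1 X Y s OX OY P Q)
  note final = final_sets[OF inv ex, folded 1(2,3,4)]
  note final_arcs = final_arcs[OF inv ex, folded 1(2,3)]
  have disj: "fwd c \<inter> bwd c = {}" and sub: "fwd c \<subseteq> V" "bwd c \<subseteq> V"
    and vw: "w \<in> fwd c" "v \<in> bwd c"
    using inv(1) by (auto simp: reach_inv_def)
  have OX: "distinct OX" "set OX = X" "E' \<inter> X \<times> X \<subseteq> before OX"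
    and OY: "distinct OY" "set OY = Y" "E' \<inter> Y \<times> Y \<subseteq> before OY"
    using 1(5,6) by (simp_all only: topological_list_iff)
  have "distinct (P @ s # Q)" "set (P @ s # Q) = V - (X \<union> Y)"
    using distinct_L set_L by (auto simp flip: 1(7))
  then have PQ: "distinct P" "distinct Q" "s \<notin> set P" "s \<notin> set Q" "set P \<inter> set Q = {}"
    "insert s (set P \<union> set Q) = V - (X \<union> Y)"
    by auto
  let ?R = "V - (X \<union> Y)"
  \<comment> \<open>\<open>P @ s # Q\<close> is \<open>L\<close> without the moved vertices, so the
    others keep their relative order.\<close>
  have before_PsQ: "(x, y) \<in> before (P @ s # Q) \<longleftrightarrow> (x, y) \<in> before L \<and> x \<notin> X \<union> Y \<and> y \<notin> X \<union> Y" for x y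
    using before_filter[of "\<lambda>x. x \<notin> X \<union> Y" L] unfolding 1(7) by blast
  have before_L: "(x, y) \<in> before L \<longleftrightarrow> x \<in> V \<and> y \<in> V \<and> p x < p y" for x y
    using before_iff_pos[OF distinct_L] set_L by simp
  have P_less: "p x < p s" if "x \<in> set P" for x
    using before_PsQ[of x s] before_L[of x s] that by auto
  have less_Q: "p s < p x" if "x \<in> set Q" for x
    using before_PsQ[of s x] before_L[of s x] that by auto
  have mem_P: "x \<in> insert s (set P)" if "x \<in> ?R" "p x \<le> p s" for x
    using less_Q[of x] that unfolding PQ(6)[symmetric] by auto
  have mem_Q: "x \<in> insert s (set Q)" if "x \<in> ?R" "p s \<le> p x" for x
    using P_less[of x] that unfolding PQ(6)[symmetric] by auto
  have L': "before (P @ s # Q) \<subseteq> before L'" "before OX \<subseteq> before L'" "before OY \<subseteq> before L'"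
    "Y \<times> X \<subseteq> before L'" "(X \<union> Y) \<times> set Q \<subseteq> before L'" "set P \<times> (X \<union> Y) \<subseteq> before L'"
    "s \<notin> fwd c \<Longrightarrow> {s} \<times> (X \<union> Y) \<subseteq> before L'" "s \<in> fwd c \<Longrightarrow> (X \<union> Y) \<times> {s} \<subseteq> before L'"
    unfolding 1(1) by (auto simp: OX(2) OY(2))
  \<comment> \<open>An arc from a staying vertex into a moved one is safe if its tail is not after
    \<open>s\<close>. The tail may be \<open>s\<close> itself only when the block goes after
    \<open>s\<close>, that is, when \<open>s\<close> is not forward. The next fact is the mirror
    image.\<close>
  have left: "(a, b) \<in> before L'"
    if "b \<in> X \<union> Y" "a \<in> ?R" "p a \<le> p s" "a = s \<Longrightarrow> s \<notin> fwd c" for a b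
    using mem_P[OF that(2,3)] that(1,4) L'(6,7) by blast
  have right: "(a, b) \<in> before L'"
    if "a \<in> X \<union> Y" "b \<in> ?R" "p s \<le> p b" "b = s \<Longrightarrow> s \<in> fwd c" for a b
    using mem_Q[OF that(2,3)] that(1,4) L'(5,8) by blast
  \<comment> \<open>Being forward or backward confines an unmoved end of the new arc to one side of
    \<open>s\<close>. This handles the only arc that runs against \<open>L\<close>.\<close>
  have w_right: "p s \<le> p w" if "w \<notin> X"
    using that vw final(2) by auto
  have v_left: "p v \<le> p s" if "v \<notin> Y"
    using that vw final(3) by auto
  have arc: "(a, b) \<in> before L'" if ab: "(a, b) \<in> E'" for a b
  proof -
    have V: "a \<in> V" "b \<in> V"
      using arc'_in_V[OF ab] by auto
    consider "(a, b) = (v, w)" | "(a, b) \<in> E"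
      using ab by blast
    then have ab_cases: "a = v \<and> b = w \<or> p a < p b"
      using arcD by cases auto
    \<comment> \<open>An arc from \<open>X\<close> to \<open>Y\<close> falls under the second
      alternative and is refuted there, since its head would be forward.\<close>
    consider "a \<in> X" "b \<in> X" | "a \<in> X" "b \<notin> X" | "a \<in> Y" "b \<in> X" | "a \<in> Y" "b \<in> Y"
      | "a \<in> Y" "b \<in> ?R" | "a \<in> ?R" "b \<in> Y" | "a \<in> ?R" "b \<in> X" | "a \<in> ?R" "b \<in> ?R"
      using V by blast
    then show ?thesis
    proof cases
      case 1
      then show ?thesis
        using ab OX(3) L'(2) by blast
    next
      case 2
      then have "b \<in> fwd c"
        using final_arcs(1)[OF ab] by simp
      with 2 show ?thesis
        using V disj final(2,3) by (intro right) auto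
    next
      case 3
      then show ?thesis
        using L'(4) by blast
    next
      case 4
      then show ?thesis
        using ab OY(3) L'(3) by blast
    next
      case 5
      then have "p s < p a"
        using final(3) by simp
      with 5 show ?thesis
        using ab_cases w_right vw by (intro right) auto
    next
      case 6
      then have "a \<in> bwd c"
        using final_arcs(2)[OF ab] by simp
      with 6 show ?thesis
        using disj final(3) by (intro left) auto
    next
      case 7
      then have "p b < p s"
        using final(2) by simp
      with 7 show ?thesis
        using ab_cases v_left vw disj by (intro left) auto
    next
      case 8
      \<comment> \<open>If both ends of the new arc stayed, \<open>v\<close> would be at or before
        \<open>s\<close> and \<open>w\<close> at or after it, contradicting
        \<open>p w < p v\<close>; so the arc is old.\<close>
      then have "p a < p b"
        using ab_cases v_left w_right p_w_less_p_v by auto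
      then have "(a, b) \<in> before (P @ s # Q)"
        using before_PsQ before_L 8 by blast
      then show ?thesis
        using L'(1) by blast
    qed
  qed
  have "distinct L'" "set L' = V"
    using 1(1) PQ OX(1,2) OY(1,2) disj final sub by auto
  with arc show ?thesis
    by (auto simp: topological_list_iff)
qed

lemma reorder_exists:
  assumes "reach_inv c" "threshold_inv c" "exhausted c"
  shows "\<exists>L'. reorder L E' c L'"
proof -
  note final = final_sets[OF assms]
  have disj: "fwd c \<inter> bwd c = {}" and sub: "fwd c \<subseteq> V" "bwd c \<subseteq> V"
    and vw: "w \<in> fwd c" "v \<in> bwd c"
    using assms(1) by (auto simp: reach_inv_def)
  \<comment> \<open>The order \<open>L\<close> restricted to \<open>S\<close> works when the new arc
    does not lie inside \<open>S\<close>; \<open>final_X\<close> misses \<open>v\<close> and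
    \<open>final_Y\<close> misses \<open>w\<close>.\<close>
  have top: "topological_list S (E' \<inter> S \<times> S) (filter (\<lambda>x. x \<in> S) L)" if "S \<subseteq> V" "v \<notin> S \<or> w \<notin> S" for S
    using that distinct_L set_L E_before by (auto simp: topological_list_iff before_filter)
  \<comment> \<open>The threshold survives the deletion: \<open>final_X\<close> lies strictly before
    it and \<open>final_Y\<close> strictly after.\<close>
  have "final_threshold c \<in> set (filter (\<lambda>x. x \<notin> final_X L c \<union> final_Y L c) L)"
    using final(1-3) set_L by auto
  then obtain P Q where "filter (\<lambda>x. x \<notin> final_X L c \<union> final_Y L c) L = P @ final_threshold c # Q"
    by (auto dest: split_list)
  moreover have "final_X L c \<subseteq> V" "v \<notin> final_X L c" "final_Y L c \<subseteq> V" "w \<notin> final_Y L c"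
    using final(2,3) disj sub vw by auto
  ultimately show ?thesis
    using reorder.intros[OF refl refl refl top top] by blast
qed

section \<open>Adding an arc\<close>

lemma add_arc_exists: "\<exists>r. add_arc L E v w r"
proof -
  \<comment> \<open>Any soft threshold from \<open>w\<close> to \<open>v\<close> would do;
    \<open>v\<close> is taken.\<close>
  define c where "c = \<lparr>lo = w, hi = v, soft = v, setA = {w}, setB = {}, setC = {v}, setD = {},
             setX = {}, setY = {}, fwd = {w}, bwd = {v}, trav = {}\<rparr>"
  have init: "initial_search L v w c"
    using p_w_less_p_v by (auto simp: initial_search_def c_def le_iff)
  obtain k where k: "(search_step L E')\<^sup>*\<^sup>* (Searching c) k" "stopped k"
    using search_stops[OF initial_inv[OF init]] by blast
  show ?thesis
  proof (cases k)
    case (Searching c')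
    then have "config_inv (Searching c')" "exhausted c'"
      using k steps_inv[OF k(1) initial_inv[OF init]] by auto
    then obtain L' where "reorder L E' c' L'"
      using reorder_exists by auto
    then show ?thesis
      using search_order[OF not_lt init k(1)[unfolded Searching]] \<open>exhausted c'\<close> by blast
  next
    case Cycle_Reported
    then show ?thesis
      using search_cycle[OF not_lt init] k(1) by blast
  qed
qed

lemma add_arc_correct:
  assumes "add_arc L E v w r"
  shows "(r = Cycle \<and> \<not> acyclic E') \<or> (\<exists>L'. r = Order L' \<and> topological_list V E' L')"
  using assms
proof cases
  case no_search
  with not_lt show ?thesis
    by simp
next
  case (search_cycle c)
  have "config_inv Cycle_Reported"
    using steps_inv[OF search_cycle(4) initial_inv[OF search_cycle(3)]] .
  then show ?thesis
    unfolding config_inv.simps using search_cycle(1) by blast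
next
  case (search_order c c' L')
  have "config_inv (Searching c')"
    using steps_inv[OF search_order(4) initial_inv[OF search_order(3)]] .
  then show ?thesis
    using search_order reorder_topological by auto
qed

end

section \<open>From one insertion to sequences of insertions\<close>

lemma arc_insertionI:
  "topological_list V E L \<Longrightarrow> v \<in> V \<Longrightarrow> w \<in> V \<Longrightarrow> v \<noteq> w \<Longrightarrow> \<not> lt L v w \<Longrightarrow> arc_insertion V L E v w"
  by (simp add: arc_insertion_def)

text \<open>If \<open>v\<close> already precedes \<open>w\<close>, the list is kept and agrees with
  the new arc; otherwise the result of the locale applies.\<close>

lemma add_arc_outcome:
  assumes "topological_list V E L" "v \<in> V" "w \<in> V" "v \<noteq> w" "add_arc L E v w r"
  shows "(r = Cycle \<and> \<not> acyclic (insert (v, w) E)) \<or>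
    (\<exists>L'. r = Order L' \<and> topological_list V (insert (v, w) E) L')"
proof (cases "lt L v w")
  case True
  with assms(1) have "topological_list V (insert (v, w) E) L"
    by (simp add: topological_list_iff lt_def)
  moreover have "r = Order L"
    using assms(5) True by cases auto
  ultimately show ?thesis
    by blast
next
  case False
  from arc_insertion.add_arc_correct[OF arc_insertionI[OF assms(1-4) this] assms(5)] show ?thesis .
qed

text \<open>Supplies the locale assumption at every stage: any order fits the empty graph, and an
  \<open>Order\<close> outcome is again topological.\<close>

lemma reachable_topological: "reachable V L E \<Longrightarrow> topological_list V E L"
proof (induction rule: reachable.induct)
  case (start L)
  then show ?case
    by (simp add: topological_list_iff order_list_def)
next
  case (add L E v w L')
  then show ?case
    using add_arc_outcome[of V E L v w "Order L'"] by blast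
qed

theorem theorem2:
  fixes V :: "'a set" and L :: "'a list" and E :: "'a rel" and v w :: 'a
  assumes "finite V"
    and "reachable V L E"
    and "v \<in> V" and "w \<in> V" and "v \<noteq> w"
  shows "(\<forall>c. \<not> lt L v w \<and> initial_search L v w c \<longrightarrow>
            search_terminates L (insert (v, w) E) (Searching c)) \<and>
         (\<forall>c c'. \<not> lt L v w \<and> initial_search L v w c \<and>
            (search_step L (insert (v, w) E))\<^sup>*\<^sup>* (Searching c) (Searching c') \<and> exhausted c' \<longrightarrow>
            (\<exists>L'. reorder L (insert (v, w) E) c' L')) \<and>
         (\<exists>r. add_arc L E v w r) \<and>
         (\<forall>r. add_arc L E v w r \<longrightarrow> (r = Cycle \<longleftrightarrow> \<not> acyclic (insert (v, w) E))) \<and>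
         (\<forall>r. add_arc L E v w r \<and> acyclic (insert (v, w) E) \<longrightarrow>
            (\<exists>L'. r = Order L' \<and> topological_list V (insert (v, w) E) L'))"
proof -
  have top: "topological_list V E L"
    using assms(2) by (rule reachable_topological)
  have ins: "arc_insertion V L E v w" if "\<not> lt L v w"
    using arc_insertionI[OF top assms(3-5) that] .
  note outcome = add_arc_outcome[OF top assms(3-5)]
  have "search_terminates L (insert (v, w) E) (Searching c)"
    if "\<not> lt L v w" "initial_search L v w c" for c
  proof -
    interpret arc_insertion V L E v w
      using ins that(1) .
    show ?thesis
      using search_terminates[OF initial_inv[OF that(2)]] .
  qed
  moreover have "\<exists>L'. reorder L (insert (v, w) E) c' L'"
    if "\<not> lt L v w" "initial_search L v w c" "exhausted c'"
      "(search_step L (insert (v, w) E))\<^sup>*\<^sup>* (Searching c) (Searching c')" for c c'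
  proof -
    interpret arc_insertion V L E v w
      using ins that(1) .
    show ?thesis
      using steps_inv[OF that(4) initial_inv[OF that(2)]] reorder_exists that(3) by auto
  qed
  moreover have "\<exists>r. add_arc L E v w r"
  proof (cases "lt L v w")
    case True
    from add_arc.no_search[OF this] show ?thesis ..
  next
    case False
    then show ?thesis
      using arc_insertion.add_arc_exists[OF ins] by simp
  qed
  \<comment> \<open>An \<open>Order\<close> outcome carries a topological list of the enlarged graph
    and so forces acyclicity; hence only \<open>Cycle\<close> is possible when a cycle
    exists.\<close>
  moreover have "r = Cycle \<longleftrightarrow> \<not> acyclic (insert (v, w) E)" if "add_arc L E v w r" for r
    using outcome[OF that] acyclic_if_topological_list by blast
  moreover have "\<exists>L'. r = Order L' \<and> topological_list V (insert (v, w) E) L'"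
    if "add_arc L E v w r" "acyclic (insert (v, w) E)" for r
    using outcome[OF that(1)] that(2) by blast
  ultimately show ?thesis
    by blast
qed

end
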